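(* Let $p=(\tau,R)$ be a mesh pattern with force $F$, and let $q=(\tau,R')$ be another mesh pattern with the same underlying permutation. Let $S=\{s_1,s_2,\dots,s_k\}=R'\setminus R$. Suppose that for each $i\in\{1,\dots,k\}$ the set $$(\tau,R\cup\{s_1,\dots,s_{i-1}\})^{s_i\star}$$ contains a mesh pattern $m$ such that either $m$ contains an occurrence of $p$ that is stronger, with respect to $F$, than the trivial occurrence of $p$ in $m$, or $m$ contains an occurrence of a mesh pattern $r$ whose containment implies containment of $q$ (i.e. every permutation containing $r$ contains $q$). Then containment of $p$ implies containment of $q$, i.e. every permutation that contains $p$ contains $q$.
   Context: Permutations, mesh patterns. A permutation $\pi\in S_n$ is a bijection of $\{1,\dots,n\}$, written as the word $\pi(1)\cdots\pi(n)$; its points are $(x,\pi(x))$. A mesh pattern is a pair $p=(\tau,R)$ with $\tau\in S_k$ and $R\subseteq\{0,\dots,k\}^2$; $(a,b)\in R$ stands for the shaded unit square $[a,a+1]\times[b,b+1]$. Occurrences. Let $\sigma\in S_n$, $\tau\in S_k$. Let $c=\sigma(u_1)\cdots\sigma(u_k)$, $u_1<\dots<u_k$, be a subsequence order isomorphic to $\tau$, with sorted values $v_1<\dots<v_k$, and $u_0=v_0=0$, $u_{k+1}=v_{k+1}=n+1$. It is an occurrence of $(\tau,R)$ in the permutation $\sigma$ if for each $(a,b)\in R$ there is no point of $\sigma$ in $(u_a,u_{a+1})\times(v_b,v_{b+1})$; it is an occurrence of $(\tau,R)$ in the mesh pattern $(\sigma,Y)$ if in addition, for each $(a,b)\in R$,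 all $(x,y)$ with $u_a\le x<u_{a+1}$, $v_b\le y<v_{b+1}$ belong to $Y$. "Contains" means having an occurrence. Adding a point. For $p=(\tau,R)$, $\tau\in S_n$, and $(i,j)\in\{0,\dots,n\}^2\setminus R$, let $\tau'\in S_{n+1}$ be obtained by inserting a new point at position $i+1$ with value $j+1$ (points of $\tau$ at positions $>i$ move one to the right, values $>j$ increase by one), and let $T'$ be the set of $(a,b)\in\{0,\dots,n+1\}^2$ with $(\phi_i(a),\phi_j(b))\in R$, where $\phi_i(a)=a$ if $a\le i$ and $\phi_i(a)=a-1$ if $a>i$. Put $p^{(i,j)\uparrow}=(\tau',T'\cup\{(i,j+1),(i+1,j+1)\})$, $p^{(i,j)\downarrow}=(\tau',T'\cup\{(i,j),(i+1,j)\})$, $p^{(i,j)\leftarrow}=(\tau',T'\cup\{(i,j),(i,j+1)\})$, $p^{(i,j)\rightarrow}=(\tau',T'\cup\{(i+1,j),(i+1,j+1)\})$, and let $p^{(i,j)\star}$ be the set of these four mesh patterns. The trivial occurrence of $p=(\tau,R)$ in a mesh pattern of $(\tau,R\cup\{s_1,\dots,s_{i-1}\})^{s_i\star}$ is the one consisting of all points other than the inserted one. Forces. A force on a mesh pattern with underlying $\tau\in S_n$ is a tuple $F=((\tau(i_1),a_1),\dots,(\tau(i_\ell),a_\ell))$ with $0\le\ell\le n$, distinct $i_j\in\{1,\dots,n\}$ and $a_j\in\{\uparrow,\downarrow,\leftarrow,\rightarrow\}$. If $c=c_1\cdots c_n$ is an occurrence in a permutation $\sigma$, or in a mesh pattern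 with underlying permutation $\sigma$, its strength with respect to $F$ is the $\ell$-tuple whose $j$-th entry is $c_{i_j}$, $-c_{i_j}$, $-\sigma^{-1}(c_{i_j})$, $\sigma^{-1}(c_{i_j})$ when $a_j$ is $\uparrow,\downarrow,\leftarrow,\rightarrow$ respectively. An occurrence is stronger than another if its strength is strictly larger in lexicographic order. *)

theory Defs
  imports Main "HOL-Combinatorics.Permutations"
begin

text \<open>
  A permutation in \<open>S\<^sub>n\<close> is a function \<open>\<sigma>\<close> with \<open>\<sigma> permutes {1..n}\<close>. Such a function does not
  determine \<open>n\<close>, so the length is always carried along explicitly.
\<close>

datatype mesh_pattern =
  Mesh (len: nat) (perm: "nat \<Rightarrow> nat") (shading: "(nat \<times> nat) set")

definition mesh_pattern :: "mesh_pattern \<Rightarrow> bool" where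
  "mesh_pattern p \<longleftrightarrow> perm p permutes {1..len p} \<and> shading p \<subseteq> {0..len p} \<times> {0..len p}"


section \<open>Occurrences\<close>

text \<open>
  A subsequence \<open>\<sigma>(u\<^sub>1) \<dots> \<sigma>(u\<^sub>k)\<close> is represented by the list \<open>us = [u\<^sub>1, \<dots>, u\<^sub>k]\<close> of its
  positions. Lists are indexed from 0, whereas positions and values start at 1.
\<close>

definition subsequence_positions :: "nat \<Rightarrow> nat list \<Rightarrow> bool" where
  "subsequence_positions n us \<longleftrightarrow> sorted_wrt (<) us \<and> set us \<subseteq> {1..n}"

definition order_isomorphic :: "nat list \<Rightarrow> nat list \<Rightarrow> bool" where
  "order_isomorphic xs ys \<longleftrightarrow> length xs = length ys \<and>
     (\<forall>i < length xs. \<forall>j < length xs. xs ! i < xs ! j \<longleftrightarrow> ys ! i < ys ! j)"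

text \<open>The sequence \<open>0, x\<^sub>1, \<dots>, x\<^sub>k, n + 1\<close>, indexed by \<open>0, \<dots>, k + 1\<close>.\<close>

definition grid_line :: "nat \<Rightarrow> nat list \<Rightarrow> nat \<Rightarrow> nat" where
  "grid_line n xs a = (0 # xs @ [n + 1]) ! a"

definition occurrence_in_perm :: "mesh_pattern \<Rightarrow> nat \<Rightarrow> (nat \<Rightarrow> nat) \<Rightarrow> nat list \<Rightarrow> bool" where
  "occurrence_in_perm p n \<sigma> us \<longleftrightarrow>
     subsequence_positions n us \<and>
     order_isomorphic (map \<sigma> us) (map (perm p) [1..<len p + 1]) \<and>
     (let u = grid_line n us; v = grid_line n (sort (map \<sigma> us)) in
       \<forall>(a, b) \<in> shading p.
         \<not> (\<exists>x \<in> {1..n}. u a < x \<and> x < u (a + 1) \<and> v b < \<sigma> x \<and> \<sigma> x < v (b + 1)))"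

definition occurrence_in_mesh :: "mesh_pattern \<Rightarrow> mesh_pattern \<Rightarrow> nat list \<Rightarrow> bool" where
  "occurrence_in_mesh p m us \<longleftrightarrow>
     occurrence_in_perm p (len m) (perm m) us \<and>
     (let u = grid_line (len m) us; v = grid_line (len m) (sort (map (perm m) us)) in
       \<forall>(a, b) \<in> shading p. \<forall>x y.
         u a \<le> x \<and> x < u (a + 1) \<and> v b \<le> y \<and> y < v (b + 1) \<longrightarrow> (x, y) \<in> shading m)"

definition perm_contains :: "nat \<Rightarrow> (nat \<Rightarrow> nat) \<Rightarrow> mesh_pattern \<Rightarrow> bool" where
  "perm_contains n \<sigma> p \<longleftrightarrow> (\<exists>us. occurrence_in_perm p n \<sigma> us)"

definition mesh_contains :: "mesh_pattern \<Rightarrow> mesh_pattern \<Rightarrow> bool" where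
  "mesh_contains m p \<longleftrightarrow> (\<exists>us. occurrence_in_mesh p m us)"

definition containment_implies :: "mesh_pattern \<Rightarrow> mesh_pattern \<Rightarrow> bool" where
  "containment_implies p q \<longleftrightarrow>
     (\<forall>n \<sigma>. \<sigma> permutes {1..n} \<longrightarrow> perm_contains n \<sigma> p \<longrightarrow> perm_contains n \<sigma> q)"


section \<open>Adding a point\<close>

datatype direction = Up | Down | Leftward | Rightward

text \<open>
  For \<open>\<tau> permutes {1..n}\<close> and \<open>i, j \<le> n\<close>, the result permutes \<open>{1..n + 1}\<close>; in particular it
  is the identity outside this set.
\<close>

definition insert_point :: "nat \<Rightarrow> nat \<Rightarrow> (nat \<Rightarrow> nat) \<Rightarrow> nat \<Rightarrow> nat" where
  "insert_point i j \<tau> x =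
     (let raise = (\<lambda>y. if y > j then y + 1 else y) in
      if x \<le> i then raise (\<tau> x)
      else if x = i + 1 then j + 1
      else raise (\<tau> (x - 1)))"

definition collapse :: "nat \<Rightarrow> nat \<Rightarrow> nat" where
  "collapse i a = (if a \<le> i then a else a - 1)"

definition inherited_shading :: "nat \<Rightarrow> nat \<Rightarrow> nat \<Rightarrow> (nat \<times> nat) set \<Rightarrow> (nat \<times> nat) set" where
  "inherited_shading n i j R =
     {(a, b) \<in> {0..n + 1} \<times> {0..n + 1}. (collapse i a, collapse j b) \<in> R}"

fun new_boxes :: "nat \<Rightarrow> nat \<Rightarrow> direction \<Rightarrow> (nat \<times> nat) set" where
  "new_boxes i j Up = {(i, j + 1), (i + 1, j + 1)}"
| "new_boxes i j Down = {(i, j), (i + 1, j)}"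
| "new_boxes i j Leftward = {(i, j), (i, j + 1)}"
| "new_boxes i j Rightward = {(i + 1, j), (i + 1, j + 1)}"

fun add_point :: "mesh_pattern \<Rightarrow> nat \<times> nat \<Rightarrow> direction \<Rightarrow> mesh_pattern" where
  "add_point (Mesh n \<tau> R) (i, j) d =
     Mesh (n + 1) (insert_point i j \<tau>) (inherited_shading n i j R \<union> new_boxes i j d)"

definition star :: "mesh_pattern \<Rightarrow> nat \<times> nat \<Rightarrow> mesh_pattern set" where
  "star p s = {add_point p s Up, add_point p s Down,
               add_point p s Leftward, add_point p s Rightward}"

text \<open>
  The trivial occurrence of a pattern of length \<open>n\<close> in the patterns obtained by inserting a
  point into the box \<open>s = (i, j)\<close>: all positions but that of the new point, \<open>i + 1\<close>.
\<close>

definition trivial_occurrence :: "nat \<Rightarrow> nat \<times> nat \<Rightarrow> nat list" where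
  "trivial_occurrence n s = filter (\<lambda>x. x \<noteq> fst s + 1) [1..<n + 2]"


section \<open>Forces\<close>

text \<open>The first components of a force are values \<open>\<tau>(i\<^sub>j)\<close>, not positions.\<close>

type_synonym force = "(nat \<times> direction) list"

definition force_on :: "nat \<Rightarrow> (nat \<Rightarrow> nat) \<Rightarrow> force \<Rightarrow> bool" where
  "force_on n \<tau> F \<longleftrightarrow>
     length F \<le> n \<and> distinct (map fst F) \<and> set (map fst F) \<subseteq> \<tau> ` {1..n}"

fun strength_entry :: "(nat \<Rightarrow> nat) \<Rightarrow> nat \<Rightarrow> direction \<Rightarrow> int" where
  "strength_entry \<sigma> c Up = int c"
| "strength_entry \<sigma> c Down = - int c"
| "strength_entry \<sigma> c Leftward = - int (inv \<sigma> c)"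
| "strength_entry \<sigma> c Rightward = int (inv \<sigma> c)"

text \<open>
  Here \<open>\<tau>\<close> underlies the pattern carrying the force, and \<open>us\<close> lists the positions in \<open>\<sigma>\<close> of an
  occurrence \<open>c = map \<sigma> us\<close>; the entry of \<open>c\<close> playing the role of the value \<open>t = \<tau>(i)\<close> is \<open>c\<^sub>i\<close>.
\<close>

definition strength :: "(nat \<Rightarrow> nat) \<Rightarrow> force \<Rightarrow> (nat \<Rightarrow> nat) \<Rightarrow> nat list \<Rightarrow> int list" where
  "strength \<tau> F \<sigma> us = map (\<lambda>(t, d). strength_entry \<sigma> (map \<sigma> us ! (inv \<tau> t - 1)) d) F"

definition stronger ::
    "(nat \<Rightarrow> nat) \<Rightarrow> force \<Rightarrow> (nat \<Rightarrow> nat) \<Rightarrow> nat list \<Rightarrow> nat list \<Rightarrow> bool" where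
  "stronger \<tau> F \<sigma> us us' \<longleftrightarrow>
     (strength \<tau> F \<sigma> us', strength \<tau> F \<sigma> us) \<in> lex {(x, y). x < y}"

end

theory Submission
  imports Defs
begin

text \<open>
  A permutation \<open>\<sigma>\<close> has only finitely many occurrences of \<open>p\<close>, so if there is any, there is one,
  say \<open>c\<close>, such that no other is stronger (\<open>strongest_occurrence\<close>). The claim is that \<open>c\<close>
  itself is an occurrence of \<open>q\<close>, or else that a step of the hypothesis produces some other
  occurrence of \<open>q\<close>.

  If \<open>c\<close> is not an occurrence of \<open>q\<close>, let \<open>s\<^sub>i\<close> be the first box of \<open>R' - R\<close> whose region with
  respect to \<open>c\<close> contains a point of \<open>\<sigma>\<close>. By the choice of \<open>i\<close>, \<open>c\<close> is an occurrence of
  \<open>(\<tau>, R \<union> {s\<^sub>1, \<dots>, s\<^sub>i\<^sub>-\<^sub>1})\<close>. Let \<open>m\<close> be the pattern that the hypothesis provides for \<open>i\<close>; it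
  comes from one of the four directions. Among the points of \<open>\<sigma>\<close> in the region of \<open>s\<^sub>i\<close>, take the
  extreme one in this direction. Together with \<open>c\<close> it forms an occurrence of \<open>m\<close>: the two boxes
  shaded around the new point are empty because the point is extreme (\<open>add_point_embedding\<close>).

  Occurrences compose: an occurrence of a pattern in \<open>m\<close>, followed by an occurrence of \<open>m\<close> in
  \<open>\<sigma>\<close>, is an occurrence of that pattern in \<open>\<sigma>\<close> (\<open>occurrence_comp\<close>). Hence, if \<open>m\<close> contains \<open>r\<close>,
  then \<open>\<sigma>\<close> contains \<open>r\<close> and so \<open>q\<close>. If instead \<open>m\<close> has an occurrence of \<open>p\<close> stronger than the
  trivial one, then composing both with the occurrence of \<open>m\<close> yields an occurrence of \<open>p\<close> in
  \<open>\<sigma>\<close> that is stronger than \<open>c\<close>: the trivial occurrence goes to \<open>c\<close>, and strict comparisons of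
  positions and of values survive the passage from \<open>m\<close> to \<open>\<sigma>\<close> (\<open>stronger_embedding\<close>). This
  contradicts the choice of \<open>c\<close>.
\<close>

section \<open>Occurrences as embeddings of grids\<close>

text \<open>
  Composing two occurrences and inserting a point are awkward for lists of positions and sorted
  lists of values, but easy for the functions \<open>W\<close> and \<open>V\<close> that send each vertical and horizontal
  grid line of the pattern, the two borders included, to its image in \<open>\<sigma>\<close>. The condition
  \<open>\<sigma> (W i) = V (\<tau> i)\<close> says that points go to points.
\<close>

definition grid_embedding ::
    "nat \<Rightarrow> (nat \<Rightarrow> nat) \<Rightarrow> nat \<Rightarrow> (nat \<Rightarrow> nat) \<Rightarrow> (nat \<Rightarrow> nat) \<Rightarrow> (nat \<Rightarrow> nat) \<Rightarrow> bool" where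
  "grid_embedding k \<tau> n \<sigma> W V \<longleftrightarrow>
     strict_mono_on {0..k + 1} W \<and> W 0 = 0 \<and> W (k + 1) = n + 1 \<and>
     strict_mono_on {0..k + 1} V \<and> V 0 = 0 \<and> V (k + 1) = n + 1 \<and>
     (\<forall>i \<in> {1..k}. \<sigma> (W i) = V (\<tau> i))"

definition box_points ::
    "nat \<Rightarrow> (nat \<Rightarrow> nat) \<Rightarrow> (nat \<Rightarrow> nat) \<Rightarrow> (nat \<Rightarrow> nat) \<Rightarrow> nat \<times> nat \<Rightarrow> nat set" where
  "box_points n \<sigma> W V s = {x \<in> {1..n}. W (fst s) < x \<and> x < W (fst s + 1) \<and>
     V (snd s) < \<sigma> x \<and> \<sigma> x < V (snd s + 1)}"

lemma grid_embeddingD: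
  assumes "grid_embedding k \<tau> n \<sigma> W V"
  shows "strict_mono_on {0..k + 1} W" "W 0 = 0" "W (k + 1) = n + 1"
    "strict_mono_on {0..k + 1} V" "V 0 = 0" "V (k + 1) = n + 1"
    "\<And>i. i \<in> {1..k} \<Longrightarrow> \<sigma> (W i) = V (\<tau> i)"
  using assms unfolding grid_embedding_def by blast+

lemma lines_less_iff:
  fixes W :: "nat \<Rightarrow> nat"
  assumes "strict_mono_on {0..k + 1} W" "a \<le> k + 1" "b \<le> k + 1"
  shows "W a < W b \<longleftrightarrow> a < b"
  using strict_mono_on_less[OF assms(1)] assms(2,3) by auto

lemma line_le:
  fixes W :: "nat \<Rightarrow> nat"
  assumes "strict_mono_on {0..k + 1} W" "W (k + 1) = n + 1" "a \<le> k + 1"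
  shows "W a \<le> n + 1"
proof (cases "a = k + 1")
  case False
  then have "W a < W (k + 1)"
    using lines_less_iff[OF assms(1), of a "k + 1"] assms(3) by auto
  then show ?thesis using assms(2) by simp
qed (use assms in simp)

lemma inner_line:
  fixes W :: "nat \<Rightarrow> nat"
  assumes "strict_mono_on {0..k + 1} W" "W 0 = 0" "W (k + 1) = n + 1" "a \<in> {1..k}"
  shows "W a \<in> {1..n}"
  using lines_less_iff[OF assms(1), of 0 a] lines_less_iff[OF assms(1), of a "k + 1"] assms by auto

lemma grid_line_mono:
  assumes "sorted_wrt (<) xs" "set xs \<subseteq> {1..n}" "length xs = k"
  shows "strict_mono_on {0..k + 1} (grid_line n xs)" "grid_line n xs 0 = 0"
    "grid_line n xs (k + 1) = n + 1"
proof -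
  let ?l = "0 # xs @ [n + 1]"
  have sorted: "sorted_wrt (<) ?l" using assms by (fastforce simp: sorted_wrt_append)
  show "strict_mono_on {0..k + 1} (grid_line n xs)"
  proof (rule strict_mono_onI)
    fix a b assume "a \<in> {0..k + 1}" "b \<in> {0..k + 1}" "a < b"
    then show "grid_line n xs a < grid_line n xs b"
      using sorted_wrt_nth_less[OF sorted, of a b] assms(3) unfolding grid_line_def by simp
  qed
qed (use assms in \<open>auto simp: grid_line_def nth_append\<close>)

lemma grid_line_map:
  assumes "W 0 = 0" "W (k + 1) = n + 1" "a \<le> k + 1"
  shows "grid_line n (map W [1..<k + 1]) a = W a"
proof (cases a)
  case (Suc b)
  then show ?thesis
  proof (cases "b = k")
    case False
    then have "b < k" using assms Suc by auto
    then show ?thesis using Suc by (auto simp: grid_line_def nth_append simp del: upt_Suc)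
  qed (use assms in \<open>auto simp: grid_line_def nth_append simp del: upt_Suc\<close>)
qed (use assms in \<open>auto simp: grid_line_def\<close>)

text \<open>
  This identifies \<open>V\<close> with the sorted values from which the definition of an occurrence builds
  its horizontal lines: both lists are strictly increasing and have the same entries, as \<open>\<tau>\<close>
  permutes the indices. Hence \<open>V\<close> is determined by the positions.
\<close>

lemma sort_values:
  assumes "\<tau> permutes {1..k}" "grid_embedding k \<tau> n \<sigma> W V"
  shows "sort (map \<sigma> (map W [1..<k + 1])) = map V [1..<k + 1]"
proof -
  note e = grid_embeddingD[OF assms(2)]
  have eq: "map \<sigma> (map W [1..<k + 1]) = map (V \<circ> \<tau>) [1..<k + 1]"
    using e(7) by (auto simp del: upt_Suc)
  have iv: "inj_on V {1..k}"
    using strict_mono_on_imp_inj_on[OF e(4)] by (rule inj_on_subset) auto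
  have s: "set [1..<k + 1] = {1..k}" by auto
  have img: "\<tau> ` {1..k} = {1..k}" using assms(1) by (rule permutes_image)
  have "inj_on \<tau> {1..k}" using permutes_inj[OF assms(1)] by (rule inj_on_subset) auto
  then have ivt: "inj_on (V \<circ> \<tau>) {1..k}" using iv img by (simp add: comp_inj_on)
  have sm: "sorted_wrt (<) (map V [1..<k + 1])"
    using lines_less_iff[OF e(4)] by (auto simp: sorted_wrt_iff_nth_less simp del: upt_Suc)
  show ?thesis unfolding eq
  proof (rule sorted_distinct_set_unique)
    show "distinct (sort (map (V \<circ> \<tau>) [1..<k + 1]))"
      using ivt s by (simp add: distinct_map del: upt_Suc)
    show "sorted (map V [1..<k + 1])" "distinct (map V [1..<k + 1])"
      using sm by (auto simp: strict_sorted_iff simp del: upt_Suc)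
    show "set (sort (map (V \<circ> \<tau>) [1..<k + 1])) = set (map V [1..<k + 1])"
      unfolding set_sort set_map s image_comp[symmetric] img ..
  qed simp
qed

lemma grid_lines_of_embedding:
  assumes "\<tau> permutes {1..k}" "grid_embedding k \<tau> n \<sigma> W V" "a \<le> k + 1"
  shows "grid_line n (map W [1..<k + 1]) a = W a"
    "grid_line n (sort (map \<sigma> (map W [1..<k + 1]))) a = V a"
  unfolding sort_values[OF assms(1,2)]
  using grid_line_map[OF grid_embeddingD(2,3)[OF assms(2)] assms(3)]
    grid_line_map[OF grid_embeddingD(5,6)[OF assms(2)] assms(3)] by simp_all

lemma embedding_order_isomorphic:
  assumes "\<tau> permutes {1..k}" "grid_embedding k \<tau> n \<sigma> W V"
  shows "subsequence_positions n (map W [1..<k + 1])"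
    "order_isomorphic (map \<sigma> (map W [1..<k + 1])) (map \<tau> [1..<k + 1])"
proof -
  note e = grid_embeddingD[OF assms(2)]
  show "subsequence_positions n (map W [1..<k + 1])"
    unfolding subsequence_positions_def
    using lines_less_iff[OF e(1)] inner_line[OF e(1-3)]
    by (auto simp: sorted_wrt_iff_nth_less image_subset_iff simp del: upt_Suc)
  have "V (\<tau> a) < V (\<tau> b) \<longleftrightarrow> \<tau> a < \<tau> b" if "a \<in> {1..k}" "b \<in> {1..k}" for a b
    using lines_less_iff[OF e(4), of "\<tau> a" "\<tau> b"] that permutes_in_image[OF assms(1)]
    by (metis atLeastAtMost_iff le_Suc_eq add.commute plus_1_eq_Suc)
  then show "order_isomorphic (map \<sigma> (map W [1..<k + 1])) (map \<tau> [1..<k + 1])"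
    unfolding order_isomorphic_def using e(7) by (auto simp del: upt_Suc)
qed

text \<open>
  The lines \<open>W\<close> are read off from the positions. For \<open>V\<close>, the image of the horizontal line \<open>y\<close> is
  taken to be the height of the entry that plays the role of the value \<open>y\<close>; this avoids
  reasoning about sorting, and order isomorphism says precisely that this \<open>V\<close> is increasing.
\<close>

lemma embedding_of_order_isomorphic:
  assumes \<tau>: "\<tau> permutes {1..k}" and \<sigma>: "\<sigma> permutes {1..n}"
    and us: "subsequence_positions n us"
    and iso: "order_isomorphic (map \<sigma> us) (map \<tau> [1..<k + 1])"
  obtains W V where "grid_embedding k \<tau> n \<sigma> W V" "us = map W [1..<k + 1]"
proof -
  have len: "length us = k" using iso by (simp add: order_isomorphic_def)
  define W where "W = grid_line n us"
  define V where "V y = (if y = 0 then 0 else if y = k + 1 then n + 1 else \<sigma> (W (inv \<tau> y)))" for y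
  have us': "sorted_wrt (<) us" "set us \<subseteq> {1..n}"
    using us by (auto simp: subsequence_positions_def)
  note W = grid_line_mono[OF us' len, folded W_def]
  have W_nth: "W i = us ! (i - 1)" if "i \<in> {1..k}" for i
    using that len by (cases i) (auto simp: W_def grid_line_def nth_append)
  have inv: "inv \<tau> y \<in> {1..k}" "\<tau> (inv \<tau> y) = y" if "y \<in> {1..k}" for y
    using that permutes_in_image[OF permutes_inv[OF \<tau>]] permutes_inverses[OF \<tau>] by auto
  have val: "\<sigma> (W i) \<in> {1..n}" if "i \<in> {1..k}" for i
    using inner_line[OF W that] permutes_in_image[OF \<sigma>] by blast
  have mono: "\<sigma> (W i) < \<sigma> (W j)" if "i \<in> {1..k}" "j \<in> {1..k}" "\<tau> i < \<tau> j" for i j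
  proof -
    have "i - 1 < k" "j - 1 < k" using that by auto
    then have "\<sigma> (us ! (i - 1)) < \<sigma> (us ! (j - 1))"
      using iso that len unfolding order_isomorphic_def by (auto simp del: upt_Suc)
    then show ?thesis using W_nth that by simp
  qed
  have "V y < V z" if "y < z" "z \<le> k + 1" for y z
  proof (cases "y = 0 \<or> z = k + 1")
    case True
    then show ?thesis
      using that val[OF inv(1), of z] val[OF inv(1), of y] by (auto simp: V_def)
  next
    case False
    then show ?thesis using that mono[OF inv(1) inv(1)] inv(2) by (auto simp: V_def)
  qed
  then have "strict_mono_on {0..k + 1} V" by (intro strict_mono_onI) auto
  moreover have "\<sigma> (W i) = V (\<tau> i)" if "i \<in> {1..k}" for i
    using permutes_in_image[OF \<tau>, of i] that permutes_inverses[OF \<tau>] by (auto simp: V_def)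
  ultimately have "grid_embedding k \<tau> n \<sigma> W V"
    using W by (auto simp: grid_embedding_def V_def)
  moreover have "us = map W [1..<k + 1]"
    using len W_nth by (intro nth_equalityI) (auto simp del: upt_Suc)
  ultimately show thesis by (rule that)
qed

lemma box_points_cong:
  assumes "W (fst s) = W' (fst s)" "W (fst s + 1) = W' (fst s + 1)"
    "V (snd s) = V' (snd s)" "V (snd s + 1) = V' (snd s + 1)"
  shows "box_points n \<sigma> W V s = box_points n \<sigma> W' V' s"
  using assms by (simp add: box_points_def)

lemma occurrence_in_perm_boxes:
  "occurrence_in_perm p n \<sigma> us \<longleftrightarrow> subsequence_positions n us \<and>
     order_isomorphic (map \<sigma> us) (map (perm p) [1..<len p + 1]) \<and>
     (\<forall>s \<in> shading p. box_points n \<sigma> (grid_line n us) (grid_line n (sort (map \<sigma> us))) s = {})"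
proof -
  have "(case s of (a, b) \<Rightarrow> \<not> (\<exists>x \<in> {1..n}. u a < x \<and> x < u (a + 1) \<and> v b < \<sigma> x \<and> \<sigma> x < v (b + 1)))
      \<longleftrightarrow> box_points n \<sigma> u v s = {}" for u v s
    unfolding box_points_def by (cases s) auto
  then show ?thesis unfolding occurrence_in_perm_def Let_def by simp
qed

lemma box_points_grid_lines:
  assumes "\<tau> permutes {1..k}" "grid_embedding k \<tau> n \<sigma> W V" "s \<in> {0..k} \<times> {0..k}"
  shows "box_points n \<sigma> (grid_line n (map W [1..<k + 1]))
      (grid_line n (sort (map \<sigma> (map W [1..<k + 1])))) s = box_points n \<sigma> W V s"
  using assms(3) by (intro box_points_cong grid_lines_of_embedding[OF assms(1,2)]) auto

lemma occurrence_of_embedding: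
  assumes "mesh_pattern p" "grid_embedding (len p) (perm p) n \<sigma> W V"
    "\<And>s. s \<in> shading p \<Longrightarrow> box_points n \<sigma> W V s = {}"
  shows "occurrence_in_perm p n \<sigma> (map W [1..<len p + 1])"
proof -
  have t: "perm p permutes {1..len p}" and sub: "shading p \<subseteq> {0..len p} \<times> {0..len p}"
    using assms(1) by (auto simp: mesh_pattern_def)
  show ?thesis
    unfolding occurrence_in_perm_boxes
    using embedding_order_isomorphic[OF t assms(2)] assms(3)
      box_points_grid_lines[OF t assms(2) subsetD[OF sub]] by blast
qed

lemma embedding_of_occurrence:
  assumes "mesh_pattern p" "\<sigma> permutes {1..n}" "occurrence_in_perm p n \<sigma> us"
  obtains W V where "grid_embedding (len p) (perm p) n \<sigma> W V" "us = map W [1..<len p + 1]"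
    "\<And>s. s \<in> shading p \<Longrightarrow> box_points n \<sigma> W V s = {}"
proof -
  have t: "perm p permutes {1..len p}" and sub: "shading p \<subseteq> {0..len p} \<times> {0..len p}"
    using assms(1) by (auto simp: mesh_pattern_def)
  have o: "subsequence_positions n us"
    "order_isomorphic (map \<sigma> us) (map (perm p) [1..<len p + 1])"
    using assms(3) by (auto simp: occurrence_in_perm_boxes)
  obtain W V where e: "grid_embedding (len p) (perm p) n \<sigma> W V" "us = map W [1..<len p + 1]"
    using embedding_of_order_isomorphic[OF t assms(2) o] by blast
  moreover have "box_points n \<sigma> W V s = {}" if "s \<in> shading p" for s
    using assms(3) that box_points_grid_lines[OF t e(1) subsetD[OF sub that]]
    unfolding occurrence_in_perm_boxes e(2) by blast
  ultimately show thesis by (rule that)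
qed


section \<open>Composing occurrences\<close>

lemma grid_embedding_comp:
  assumes \<rho>: "\<rho> permutes {1..k}" and U: "grid_embedding k \<rho> m \<mu> U T"
    and W: "grid_embedding m \<mu> n \<sigma> W V"
  shows "grid_embedding k \<rho> n \<sigma> (W \<circ> U) (V \<circ> T)"
proof -
  note u = grid_embeddingD[OF U] and w = grid_embeddingD[OF W]
  have comp: "strict_mono_on {0..k + 1} (f \<circ> g)"
    if "strict_mono_on {0..m + 1} f" "strict_mono_on {0..k + 1} g" "g (k + 1) = m + 1"
    for f g :: "nat \<Rightarrow> nat"
  proof (rule strict_mono_onI)
    fix a b assume "a \<in> {0..k + 1}" "b \<in> {0..k + 1}" "a < b"
    then show "(f \<circ> g) a < (f \<circ> g) b"
      using lines_less_iff[OF that(2), of a b] line_le[OF that(2,3), of a]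
        line_le[OF that(2,3), of b] lines_less_iff[OF that(1), of "g a" "g b"] by auto
  qed
  have "\<sigma> (W (U i)) = V (T (\<rho> i))" if "i \<in> {1..k}" for i
    using w(7)[OF inner_line[OF u(1-3) that]] u(7)[OF that] by simp
  then show ?thesis
    using u w comp[OF w(1) u(1,3)] comp[OF w(4) u(4,6)] by (simp add: grid_embedding_def)
qed

text \<open>
  Discrete intermediate value argument: a number between two lines lies in one of the strips that
  the intermediate lines cut out. The left border belongs to the strip, so that a point lying on a
  line is located as well.
\<close>

lemma between_consecutive_lines:
  fixes f :: "nat \<Rightarrow> nat"
  assumes "f i \<le> x" "x < f j" "i \<le> j"
  obtains c where "i \<le> c" "c < j" "f c \<le> x" "x < f (c + 1)"
proof -
  have "\<exists>c. i \<le> c \<and> c < j \<and> f c \<le> x \<and> x < f (c + 1)"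
    using assms(3,2)
  proof (induction j rule: dec_induct)
    case base
    then show ?case using assms(1) by simp
  next
    case (step j)
    then show ?case
      by (cases "x < f j") (use less_Suc_eq in \<open>auto simp: not_less\<close>)
  qed
  then show thesis using that by blast
qed

text \<open>
  Seen from \<open>\<sigma>\<close>, a box of the pattern \<open>\<rho>\<close> is a union of cells of the grid of \<open>\<mu>\<close>, together with
  the lines between them. A point of \<open>\<sigma>\<close> in the box and on one of these lines is the image of a
  point of \<open>\<mu>\<close>, which then lies in the corresponding box in \<open>\<mu>\<close>; a point off the lines lies in the
  interior of one of the cells.
\<close>

lemma box_points_comp:
  assumes \<mu>: "\<mu> permutes {1..m}" and \<sigma>: "\<sigma> permutes {1..n}"
    and U: "grid_embedding k \<rho> m \<mu> U T" and W: "grid_embedding m \<mu> n \<sigma> W V"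
    and s: "a \<le> k" "b \<le> k"
    and pts: "box_points m \<mu> U T (a, b) = {}"
    and cells: "\<And>c d. \<lbrakk>U a \<le> c; c < U (a + 1); T b \<le> d; d < T (b + 1)\<rbrakk>
      \<Longrightarrow> box_points n \<sigma> W V (c, d) = {}"
  shows "box_points n \<sigma> (W \<circ> U) (V \<circ> T) (a, b) = {}"
proof (rule ccontr)
  note u = grid_embeddingD[OF U] and w = grid_embeddingD[OF W]
  assume "box_points n \<sigma> (W \<circ> U) (V \<circ> T) (a, b) \<noteq> {}"
  then obtain x where x: "x \<in> {1..n}" "W (U a) < x" "x < W (U (a + 1))"
    "V (T b) < \<sigma> x" "\<sigma> x < V (T (b + 1))"
    by (auto simp: box_points_def)
  have le: "U a \<le> U (a + 1)" "T b \<le> T (b + 1)" "U (a + 1) \<le> m + 1" "T (b + 1) \<le> m + 1"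
    using lines_less_iff[OF u(1), of a "a + 1"] lines_less_iff[OF u(4), of b "b + 1"] s
      line_le[OF u(1,3), of "a + 1"] line_le[OF u(4,6), of "b + 1"] by auto
  obtain c where c: "U a \<le> c" "c < U (a + 1)" "W c \<le> x" "x < W (c + 1)"
    using between_consecutive_lines[of W "U a" x "U (a + 1)"] x le by auto
  obtain d where d: "T b \<le> d" "d < T (b + 1)" "V d \<le> \<sigma> x" "\<sigma> x < V (d + 1)"
    using between_consecutive_lines[of V "T b" "\<sigma> x" "T (b + 1)"] x le by auto
  show False
  proof (cases "W c = x")
    case True
    then have cU: "U a < c" using x(2) c(1) by (cases "U a = c") auto
    then have cm: "c \<in> {1..m}" using c(2) le(3) by auto
    have val: "\<sigma> x = V (\<mu> c)" using w(7)[OF cm] True by simp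
    have "\<mu> c \<in> {1..m}" using permutes_in_image[OF \<mu>] cm by blast
    then have "T b < \<mu> c" "\<mu> c < T (b + 1)"
      using x(4,5) val lines_less_iff[OF w(4), of "T b" "\<mu> c"]
        lines_less_iff[OF w(4), of "\<mu> c" "T (b + 1)"] le by auto
    then have "c \<in> box_points m \<mu> U T (a, b)"
      using cU c(2) cm by (auto simp: box_points_def)
    then show False using pts by simp
  next
    case False
    \<comment> \<open>A point of \<open>\<sigma>\<close> on a horizontal line of \<open>\<mu>\<close> is the image of a point of \<open>\<mu>\<close>, so it is on a vertical
      line as well, which was excluded.\<close>
    have "V d \<noteq> \<sigma> x"
    proof
      assume eq: "V d = \<sigma> x"
      then have "T b < d" using x(4) d(1) by (cases "T b = d") auto
      then have dm: "d \<in> {1..m}" using d(2) le(4) by auto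
      then obtain e where e: "e \<in> {1..m}" "d = \<mu> e"
        using permutes_image[OF \<mu>] by (metis imageE)
      then have "\<sigma> (W e) = \<sigma> x" using w(7) eq by simp
      then have "W e = x" using permutes_inj[OF \<sigma>] by (auto dest: injD)
      then have "W c < W e" "W e < W (c + 1)" using False c(3,4) by auto
      then show False
        using lines_less_iff[OF w(1), of c e] lines_less_iff[OF w(1), of e "c + 1"]
          e(1) c(2) le(3) by auto
    qed
    then have "x \<in> box_points n \<sigma> W V (c, d)"
      using False c d x(1) by (auto simp: box_points_def)
    then show False using cells[OF c(1,2) d(1,2)] by simp
  qed
qed

text \<open>
  An occurrence in the mesh pattern \<open>m\<close>, and not merely in its underlying permutation, is what is
  needed: all the cells of \<open>m\<close> that make up a shaded box of \<open>p\<close> are then shaded in \<open>m\<close>, hence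
  empty in \<open>\<sigma>\<close>.
\<close>

lemma occurrence_comp:
  assumes p: "mesh_pattern p" and m: "mesh_pattern m" and \<sigma>: "\<sigma> permutes {1..n}"
    and us: "occurrence_in_mesh p m us"
    and W: "grid_embedding (len m) (perm m) n \<sigma> W V"
    and boxes: "\<And>s. s \<in> shading m \<Longrightarrow> box_points n \<sigma> W V s = {}"
  shows "occurrence_in_perm p n \<sigma> (map W us)"
proof -
  have t: "perm p permutes {1..len p}" and sub: "shading p \<subseteq> {0..len p} \<times> {0..len p}"
    and \<mu>: "perm m permutes {1..len m}"
    using p m by (auto simp: mesh_pattern_def)
  have "occurrence_in_perm p (len m) (perm m) us"
    using us by (simp add: occurrence_in_mesh_def)
  then obtain U T where U: "grid_embedding (len p) (perm p) (len m) (perm m) U T"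
    and us_eq: "us = map U [1..<len p + 1]"
    and pts: "\<And>s. s \<in> shading p \<Longrightarrow> box_points (len m) (perm m) U T s = {}"
    using embedding_of_occurrence[OF p \<mu>] by blast
  note lines = grid_lines_of_embedding[OF t U, folded us_eq]
  have "box_points n \<sigma> (W \<circ> U) (V \<circ> T) s = {}" if "s \<in> shading p" for s
  proof -
    obtain a b where s: "s = (a, b)" by force
    have ab: "a \<le> len p" "b \<le> len p" using sub that s by auto
    have "(c, d) \<in> shading m" if "U a \<le> c" "c < U (a + 1)" "T b \<le> d" "d < T (b + 1)" for c d
      using us \<open>s \<in> shading p\<close> that lines(1)[of a] lines(1)[of "a + 1"] lines(2)[of b]
        lines(2)[of "b + 1"] ab
      unfolding occurrence_in_mesh_def Let_def s by force
    then show ?thesis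
      unfolding s using pts[OF that] s boxes
      by (intro box_points_comp[OF \<mu> \<sigma> U W ab]) auto
  qed
  from occurrence_of_embedding[OF p grid_embedding_comp[OF t U W] this]
  show ?thesis by (simp add: us_eq del: upt_Suc)
qed


section \<open>Forces\<close>

text \<open>
  Each entry of a strength is, up to sign, the value or the position of a point, and an embedding
  is strictly increasing in both. As the equivalence also holds with \<open>y\<close> and \<open>z\<close> exchanged, ties
  are preserved too, which the lexicographic comparison needs.
\<close>

lemma strength_entry_embedding:
  assumes \<mu>: "\<mu> permutes {1..m}" and \<sigma>: "\<sigma> permutes {1..n}"
    and W: "grid_embedding m \<mu> n \<sigma> W V" and y: "y \<in> {1..m}" "z \<in> {1..m}"
  shows "strength_entry \<sigma> (\<sigma> (W y)) d < strength_entry \<sigma> (\<sigma> (W z)) d \<longleftrightarrow>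
    strength_entry \<mu> (\<mu> y) d < strength_entry \<mu> (\<mu> z) d"
proof -
  note w = grid_embeddingD[OF W]
  have "\<mu> y \<in> {1..m}" "\<mu> z \<in> {1..m}" using y permutes_in_image[OF \<mu>] by blast+
  then have "V (\<mu> y) < V (\<mu> z) \<longleftrightarrow> \<mu> y < \<mu> z" "V (\<mu> z) < V (\<mu> y) \<longleftrightarrow> \<mu> z < \<mu> y"
    using lines_less_iff[OF w(4)] by auto
  moreover have "W y < W z \<longleftrightarrow> y < z" "W z < W y \<longleftrightarrow> z < y"
    using lines_less_iff[OF w(1)] y by auto
  ultimately show ?thesis
    using w(7)[OF y(1)] w(7)[OF y(2)] permutes_inverses[OF \<mu>]
      inv_f_f[OF permutes_inj[OF \<sigma>], of "W y"] inv_f_f[OF permutes_inj[OF \<sigma>], of "W z"]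
    by (cases d) auto
qed

lemma lex_map_cong:
  fixes f g f' g' :: "'a \<Rightarrow> int"
  assumes "(map f xs, map g xs) \<in> lex {(x, y). x < y}"
    "\<And>x. x \<in> set xs \<Longrightarrow> f x < g x \<longleftrightarrow> f' x < g' x"
    "\<And>x. x \<in> set xs \<Longrightarrow> g x < f x \<longleftrightarrow> g' x < f' x"
  shows "(map f' xs, map g' xs) \<in> lex {(x, y). x < y}"
  using assms
proof (induction xs)
  case (Cons x xs)
  have "f x < g x \<longleftrightarrow> f' x < g' x" "g x < f x \<longleftrightarrow> g' x < f' x" using Cons.prems(2,3) by auto
  then have "f x = g x \<longleftrightarrow> f' x = g' x" by linarith
  then show ?case using Cons by (auto simp: Cons_in_lex)
qed simp

lemma stronger_embedding:
  assumes \<tau>: "\<tau> permutes {1..k}" and F: "force_on k \<tau> F"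
    and \<mu>: "\<mu> permutes {1..m}" and \<sigma>: "\<sigma> permutes {1..n}"
    and W: "grid_embedding m \<mu> n \<sigma> W V"
    and us: "length us = k" "set us \<subseteq> {1..m}" and vs: "length vs = k" "set vs \<subseteq> {1..m}"
    and "stronger \<tau> F \<mu> us vs"
  shows "stronger \<tau> F \<sigma> (map W us) (map W vs)"
proof -
  have idx: "inv \<tau> t - 1 < k" if "(t, d) \<in> set F" for t d
  proof -
    have "t \<in> \<tau> ` {1..k}" using F that by (force simp: force_on_def)
    then show ?thesis using permutes_inverses[OF \<tau>] by auto
  qed
  have mem: "us ! i \<in> {1..m}" "vs ! i \<in> {1..m}" if "i < k" for i
    using that us(1) vs(1) subsetD[OF us(2) nth_mem[of i us]] subsetD[OF vs(2) nth_mem[of i vs]]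
    by simp_all
  show ?thesis
    using assms(10) unfolding stronger_def strength_def
  proof (rule lex_map_cong, goal_cases)
    case (1 x)
    then show ?case using idx[of "fst x" "snd x"] us(1) vs(1) mem
        strength_entry_embedding[OF \<mu> \<sigma> W, symmetric] by (auto split: prod.splits)
  next
    case (2 x)
    then show ?case using idx[of "fst x" "snd x"] us(1) vs(1) mem
        strength_entry_embedding[OF \<mu> \<sigma> W, symmetric] by (auto split: prod.splits)
  qed
qed

lemma trans_stronger:
  "stronger \<tau> F \<sigma> us vs \<Longrightarrow> stronger \<tau> F \<sigma> vs ws \<Longrightarrow> stronger \<tau> F \<sigma> us ws"
  unfolding stronger_def by (rule transD[OF lex_transI]) (auto intro: transI)

lemma irrefl_stronger: "\<not> stronger \<tau> F \<sigma> us us"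
proof -
  have "(xs, xs) \<notin> lex {(x, y). x < y}" for xs :: "int list"
    by (induction xs) (auto simp: Cons_in_lex)
  then show ?thesis by (simp add: stronger_def)
qed

lemma finite_occurrences: "finite {us. occurrence_in_perm p n \<sigma> us}"
proof (rule finite_subset)
  show "{us. occurrence_in_perm p n \<sigma> us} \<subseteq> {us. set us \<subseteq> {1..n} \<and> length us = len p}"
    by (auto simp: occurrence_in_perm_def subsequence_positions_def order_isomorphic_def
        simp del: upt_Suc)
qed (simp add: finite_lists_length_eq)

text \<open>
  Being stronger is a strict partial order, so it has a maximal element on the finite nonempty set
  of occurrences.
\<close>

lemma strongest_occurrence:
  assumes "perm_contains n \<sigma> p"
  obtains us where "occurrence_in_perm p n \<sigma> us"
    "\<And>vs. occurrence_in_perm p n \<sigma> vs \<Longrightarrow> \<not> stronger \<tau> F \<sigma> vs us"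
proof -
  let ?A = "{us. occurrence_in_perm p n \<sigma> us}" and ?R = "\<lambda>us vs. stronger \<tau> F \<sigma> vs us"
  have "\<exists>us \<in> ?A. \<forall>vs \<in> ?A. vs \<noteq> us \<longrightarrow> \<not> ?R us vs"
  proof (rule Finite_Set.bex_max_element[OF finite_occurrences])
    show "asymp_on ?A ?R" by (rule asymp_onI) (metis trans_stronger irrefl_stronger)
    show "transp_on ?A ?R" by (rule transp_onI) (metis trans_stronger)
    show "?A \<noteq> {}" using assms by (auto simp: perm_contains_def)
  qed
  then show thesis using that irrefl_stronger by (metis mem_Collect_eq)
qed


section \<open>Adding a point of an occupied box\<close>

lemma insert_point_permutes:
  assumes \<tau>: "\<tau> permutes {1..n}" and ij: "i \<le> n" "j \<le> n"
  shows "insert_point i j \<tau> permutes {1..n + 1}"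
proof (rule bij_imp_permutes)
  let ?f = "insert_point i j \<tau>"
  have le: "\<tau> x \<in> {1..n}" if "x \<in> {1..n}" for x
    using permutes_in_image[OF \<tau>] that by blast
  have eq: "\<tau> x = \<tau> y \<longleftrightarrow> x = y" for x y using permutes_inj[OF \<tau>] by (auto dest: injD)
  have inj: "inj_on ?f {1..n + 1}"
  proof (rule inj_onI)
    fix x y assume "x \<in> {1..n + 1}" "y \<in> {1..n + 1}" "?f x = ?f y"
    then show "x = y"
      using eq[of x y] eq[of "x - 1" y] eq[of x "y - 1"] eq[of "x - 1" "y - 1"]
      by (auto simp: insert_point_def Let_def split: if_splits)
  qed
  have "?f x \<in> {1..n + 1}" if "x \<in> {1..n + 1}" for x
  proof -
    consider "x \<le> i" | "x = i + 1" | "i + 1 < x" by linarith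
    then show ?thesis
    proof cases
      case 3
      then have "x - 1 \<in> {1..n}" using that by auto
      from le[OF this] 3 show ?thesis by (auto simp: insert_point_def Let_def)
    qed (use that le[of x] ij in \<open>auto simp: insert_point_def Let_def\<close>)
  qed
  then have "?f ` {1..n + 1} = {1..n + 1}"
    by (intro endo_inj_surj inj) auto
  then show "bij_betw ?f {1..n + 1} {1..n + 1}" using inj by (simp add: bij_betw_def)
  fix x assume "x \<notin> {1..n + 1}"
  then consider "x = 0" | "n + 1 < x" by fastforce
  then show "?f x = x"
  proof cases
    case 1
    then show ?thesis using permutes_not_in[OF \<tau>, of 0] by (simp add: insert_point_def)
  next
    case 2
    then have "\<tau> (x - 1) = x - 1" by (intro permutes_not_in[OF \<tau>]) auto
    then show ?thesis using 2 ij by (simp add: insert_point_def)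
  qed
qed

lemma mesh_pattern_add_point:
  assumes "mesh_pattern (Mesh n \<tau> R)" "i \<le> n" "j \<le> n"
  shows "mesh_pattern (add_point (Mesh n \<tau> R) (i, j) d)"
  using assms insert_point_permutes[of \<tau> n i j]
  by (cases d) (auto simp: mesh_pattern_def inherited_shading_def)

text \<open>
  The image lines after an additional line, sent to \<open>x\<close>, has been inserted right after line \<open>i\<close>;
  used both for vertical and for horizontal lines.
\<close>

definition insert_line :: "nat \<Rightarrow> nat \<Rightarrow> (nat \<Rightarrow> nat) \<Rightarrow> nat \<Rightarrow> nat" where
  "insert_line i x W a = (if a \<le> i then W a else if a = i + 1 then x else W (a - 1))"

lemma insert_line_mono:
  assumes W: "strict_mono_on {0..n + 1} W" and i: "i \<le> n" "W i < x" "x < W (i + 1)"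
  shows "strict_mono_on {0..n + 2} (insert_line i x W)"
proof (rule strict_mono_onI)
  note less = lines_less_iff[OF W]
  fix a b assume ab: "a \<in> {0..n + 2}" "b \<in> {0..n + 2}" "a < b"
  have lo: "W c < x" if "c \<le> i" for c
    using less[of c i] that i by (cases "c = i") auto
  have hi: "x < W c" if "i < c" "c \<le> n + 1" for c
    using less[of "i + 1" c] that i by (cases "c = i + 1") auto
  show "insert_line i x W a < insert_line i x W b"
    using ab lo[of a] hi[of "b - 1"] less[of a b] less[of a "b - 1"] less[of "a - 1" "b - 1"] i
    by (auto simp: insert_line_def)
qed

lemma insert_point_embedding:
  assumes \<tau>: "\<tau> permutes {1..n}" and W: "grid_embedding n \<tau> N \<sigma> W V"
    and ij: "i \<le> n" "j \<le> n" and x: "x \<in> box_points N \<sigma> W V (i, j)"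
  shows "grid_embedding (n + 1) (insert_point i j \<tau>) N \<sigma> (insert_line i x W) (insert_line j (\<sigma> x) V)"
proof -
  note w = grid_embeddingD[OF W]
  have "\<sigma> (insert_line i x W a) = insert_line j (\<sigma> x) V (insert_point i j \<tau> a)"
    if "a \<in> {1..n + 1}" for a
  proof -
    consider "a \<le> i" | "a = i + 1" | "i + 1 < a" by linarith
    then show ?thesis
    proof cases
      case 3
      then have "a - 1 \<in> {1..n}" using that by auto
      from w(7)[OF this] 3 show ?thesis
        by (auto simp: insert_line_def insert_point_def Let_def)
    qed (use that w(7)[of a] ij in \<open>auto simp: insert_line_def insert_point_def Let_def\<close>)
  qed
  moreover have "strict_mono_on {0..n + 1 + 1} (insert_line i x W)"
    "strict_mono_on {0..n + 1 + 1} (insert_line j (\<sigma> x) V)"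
    using insert_line_mono[OF w(1), of i x] insert_line_mono[OF w(4), of j "\<sigma> x"] x ij
    by (auto simp: box_points_def)
  ultimately show ?thesis
    using w ij by (simp add: grid_embedding_def) (simp add: insert_line_def)
qed

text \<open>
  The index \<open>collapse i a\<close> is that of the old strip from which the new strip \<open>a\<close> is cut.
\<close>

lemma insert_line_cell:
  assumes "W i < x" "x < W (i + 1)"
    and "insert_line i x W a < z" "z < insert_line i x W (a + 1)"
  shows "W (collapse i a) < z" "z < W (collapse i a + 1)"
proof -
  consider "a < i" | "a = i" | "a = i + 1" | "i + 1 < a" by linarith
  then have "W (collapse i a) < z \<and> z < W (collapse i a + 1)"
    using assms by cases (auto simp: insert_line_def collapse_def)
  then show "W (collapse i a) < z" "z < W (collapse i a + 1)" by auto
qed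

lemma inherited_box_empty:
  assumes x: "x \<in> box_points N \<sigma> W V (i, j)"
    and "box_points N \<sigma> W V (collapse i a, collapse j b) = {}"
  shows "box_points N \<sigma> (insert_line i x W) (insert_line j (\<sigma> x) V) (a, b) = {}"
  using x assms(2) insert_line_cell[of W i x a] insert_line_cell[of V j "\<sigma> x" b]
  unfolding box_points_def by fastforce

text \<open>
  \<open>extreme \<sigma> d x y\<close>: the point of \<open>\<sigma>\<close> at position \<open>x\<close> reaches at least as far in direction \<open>d\<close> as
  the one at position \<open>y\<close>.
\<close>

fun extreme :: "(nat \<Rightarrow> nat) \<Rightarrow> direction \<Rightarrow> nat \<Rightarrow> nat \<Rightarrow> bool" where
  "extreme \<sigma> Up x y \<longleftrightarrow> \<sigma> y \<le> \<sigma> x"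
| "extreme \<sigma> Down x y \<longleftrightarrow> \<sigma> x \<le> \<sigma> y"
| "extreme \<sigma> Leftward x y \<longleftrightarrow> x \<le> y"
| "extreme \<sigma> Rightward x y \<longleftrightarrow> y \<le> x"

lemma extreme_point:
  assumes "finite A" "A \<noteq> {}"
  obtains x where "x \<in> A" "\<And>y. y \<in> A \<Longrightarrow> extreme \<sigma> d x y"
proof (cases d)
  case Up
  from assms obtain x where "x \<in> A" "\<sigma> x = Max (\<sigma> ` A)" using Max_in[of "\<sigma> ` A"] by fastforce
  then show thesis using that[of x] assms Up by simp
next
  case Down
  from assms obtain x where "x \<in> A" "\<sigma> x = Min (\<sigma> ` A)" using Min_in[of "\<sigma> ` A"] by fastforce
  then show thesis using that[of x] assms Down by simp
next
  case Leftward
  then show thesis using that[of "Min A"] assms by simp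
next
  case Rightward
  then show thesis using that[of "Max A"] assms by simp
qed

text \<open>
  The two boxes in \<open>new_boxes i j d\<close> are cut from the old box \<open>(i, j)\<close>, and a point in one of them
  would be a point of the old box lying strictly further in direction \<open>d\<close> than the one at \<open>x\<close>.
\<close>

lemma new_box_empty:
  assumes x: "x \<in> box_points N \<sigma> W V (i, j)"
    and ext: "\<And>y. y \<in> box_points N \<sigma> W V (i, j) \<Longrightarrow> extreme \<sigma> d x y"
    and s: "s \<in> new_boxes i j d"
  shows "box_points N \<sigma> (insert_line i x W) (insert_line j (\<sigma> x) V) s = {}"
proof (rule ccontr)
  assume "box_points N \<sigma> (insert_line i x W) (insert_line j (\<sigma> x) V) s \<noteq> {}"
  then obtain y where y: "y \<in> box_points N \<sigma> (insert_line i x W) (insert_line j (\<sigma> x) V) s"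
    by auto
  have "collapse i (fst s) = i" "collapse j (snd s) = j"
    using s by (cases d; auto simp: collapse_def)+
  then have "y \<in> box_points N \<sigma> W V (i, j)"
    using x y insert_line_cell[of W i x "fst s" y] insert_line_cell[of V j "\<sigma> x" "snd s" "\<sigma> y"]
    by (auto simp: box_points_def)
  then have "extreme \<sigma> d x y" by (rule ext)
  then show False using y s by (cases d) (auto simp: box_points_def insert_line_def)
qed

lemma map_insert_line_trivial_occurrence:
  assumes "i \<le> n"
  shows "map (insert_line i x W) (trivial_occurrence n (i, j)) = map W [1..<n + 1]"
proof -
  \<comment> \<open>The new point has position \<open>i + 1\<close>; the positions after it are those of the old points, shifted
    by one, and \<open>insert_line\<close> undoes the shift.\<close>
  have "[1..<n + 2] = [1..<i + 1] @ [i + 1] @ [i + 2..<n + 2]"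
    using assms upt_add_eq_append[of 1 "i + 1" "n + 1 - i"] by (simp add: upt_conv_Cons)
  then have "trivial_occurrence n (i, j) = [1..<i + 1] @ [i + 2..<n + 2]"
    by (simp add: trivial_occurrence_def filter_id_conv del: upt_Suc)
  moreover have "[i + 2..<n + 2] = map Suc [i + 1..<n + 1]" by (simp add: map_Suc_upt del: upt_Suc)
  moreover have "[1..<n + 1] = [1..<i + 1] @ [i + 1..<n + 1]"
    using assms upt_add_eq_append[of 1 "i + 1" "n - i"] by simp
  ultimately show ?thesis by (simp add: insert_line_def del: upt_Suc)
qed

text \<open>
  If the box \<open>(i, j)\<close> is occupied, the permutation contains all four patterns of the star:
  whichever direction \<open>d\<close> is prescribed, the occurrence extends by the point of the box that is
  extreme in this direction. The last conclusion says that the original occurrence is recovered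
  as the image of the trivial one, which makes strengths comparable.
\<close>

lemma add_point_embedding:
  assumes p: "mesh_pattern (Mesh n \<tau> R)" and W: "grid_embedding n \<tau> N \<sigma> W V"
    and boxes: "\<And>s. s \<in> R \<Longrightarrow> box_points N \<sigma> W V s = {}"
    and ij: "i \<le> n" "j \<le> n" and occupied: "box_points N \<sigma> W V (i, j) \<noteq> {}"
    and m: "m = add_point (Mesh n \<tau> R) (i, j) d"
  obtains W' V' where "grid_embedding (len m) (perm m) N \<sigma> W' V'"
    "\<And>s. s \<in> shading m \<Longrightarrow> box_points N \<sigma> W' V' s = {}"
    "map W' (trivial_occurrence n (i, j)) = map W [1..<n + 1]"
proof -
  have "finite (box_points N \<sigma> W V (i, j))" by (simp add: box_points_def)
  then obtain x where x: "x \<in> box_points N \<sigma> W V (i, j)"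
    and ext: "\<And>y. y \<in> box_points N \<sigma> W V (i, j) \<Longrightarrow> extreme \<sigma> d x y"
    using extreme_point[OF _ occupied] by blast
  have \<tau>: "\<tau> permutes {1..n}" using p by (simp add: mesh_pattern_def)
  show thesis
  proof (rule that)
    show "grid_embedding (len m) (perm m) N \<sigma> (insert_line i x W) (insert_line j (\<sigma> x) V)"
      using insert_point_embedding[OF \<tau> W ij x] m by simp
    show "box_points N \<sigma> (insert_line i x W) (insert_line j (\<sigma> x) V) s = {}"
      if "s \<in> shading m" for s
      using that m new_box_empty[OF x ext] inherited_box_empty[OF x boxes]
      by (cases s) (auto simp: inherited_shading_def)
  qed (rule map_insert_line_trivial_occurrence[OF ij(1)])
qed

section \<open>The shading criterion\<close>

theorem lemma2p13:
  fixes n :: nat and \<tau> :: "nat \<Rightarrow> nat" and R R' :: "(nat \<times> nat) set"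
    and p q :: mesh_pattern and F :: force and ss :: "(nat \<times> nat) list"
  assumes p: "p = Mesh n \<tau> R" "mesh_pattern p"
    and F: "force_on n \<tau> F"
    and q: "q = Mesh n \<tau> R'" "mesh_pattern q"
    and ss: "distinct ss" "set ss = R' - R"
    and step: "\<And>i. i < length ss \<Longrightarrow>
      \<exists>m \<in> star (Mesh n \<tau> (R \<union> set (take i ss))) (ss ! i).
        (\<exists>us. occurrence_in_mesh p m us \<and>
              stronger \<tau> F (perm m) us (trivial_occurrence n (ss ! i)))
        \<or> (\<exists>r. mesh_pattern r \<and> mesh_contains m r \<and> containment_implies r q)"
  shows "containment_implies p q"
  unfolding containment_implies_def
proof (intro allI impI)
  fix N \<sigma> assume \<sigma>: "\<sigma> permutes {1..N}" and "perm_contains N \<sigma> p"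
  then obtain us where us: "occurrence_in_perm p N \<sigma> us"
    and strongest: "\<And>vs. occurrence_in_perm p N \<sigma> vs \<Longrightarrow> \<not> stronger \<tau> F \<sigma> vs us"
    using strongest_occurrence by metis
  obtain W V where W: "grid_embedding n \<tau> N \<sigma> W V" and us_eq: "us = map W [1..<n + 1]"
    and boxes: "\<And>s. s \<in> R \<Longrightarrow> box_points N \<sigma> W V s = {}"
    using embedding_of_occurrence[OF p(2) \<sigma> us] p(1) by auto
  have \<tau>: "\<tau> permutes {1..n}" and R: "R \<subseteq> {0..n} \<times> {0..n}" "R' \<subseteq> {0..n} \<times> {0..n}"
    using p q by (auto simp: mesh_pattern_def)
  show "perm_contains N \<sigma> q"
  proof (cases "\<exists>l < length ss. box_points N \<sigma> W V (ss ! l) \<noteq> {}")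
    case False
    then have "box_points N \<sigma> W V s = {}" if "s \<in> R'" for s
    proof (cases "s \<in> R")
      case False
      then have "s \<in> set ss" using that ss(2) by blast
      then show ?thesis
        using \<open>\<not> (\<exists>l < length ss. box_points N \<sigma> W V (ss ! l) \<noteq> {})\<close> by (metis in_set_conv_nth)
    qed (rule boxes)
    then have "occurrence_in_perm q N \<sigma> us"
      using occurrence_of_embedding[OF q(2)] W q(1) us_eq by simp
    then show ?thesis by (auto simp: perm_contains_def)
  next
    case True
    \<comment> \<open>The first occupied box is the one to use: since the boxes before it are empty, the occurrence
      is one of the pattern with these boxes shaded, to which the point is added.\<close>
    define l where "l = (LEAST l. l < length ss \<and> box_points N \<sigma> W V (ss ! l) \<noteq> {})"
    have l: "l < length ss" "box_points N \<sigma> W V (ss ! l) \<noteq> {}"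
      using LeastI_ex[OF True] by (simp_all add: l_def)
    have before: "box_points N \<sigma> W V (ss ! l') = {}" if "l' < l" for l'
      using not_less_Least[of l' "\<lambda>l. l < length ss \<and> box_points N \<sigma> W V (ss ! l) \<noteq> {}"]
        that l(1) by (auto simp: l_def)
    define R1 where "R1 = R \<union> set (take l ss)"
    obtain i j where ij_eq: "ss ! l = (i, j)" by force
    have "set ss \<subseteq> {0..n} \<times> {0..n}" using ss(2) R by auto
    then have ij: "i \<le> n" "j \<le> n" and p1: "mesh_pattern (Mesh n \<tau> R1)"
      using nth_mem[OF l(1)] ij_eq R \<tau> set_take_subset[of l ss]
      by (auto simp: mesh_pattern_def R1_def)
    have boxes1: "box_points N \<sigma> W V s = {}" if "s \<in> R1" for s
    proof (cases "s \<in> R")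
      case False
      then have "s \<in> set (take l ss)" using that by (simp add: R1_def)
      then obtain l' where "l' < l" "s = ss ! l'" by (auto simp: in_set_conv_nth)
      then show ?thesis using before by simp
    qed (rule boxes)
    obtain m where "m \<in> star (Mesh n \<tau> R1) (i, j)" and alt:
      "(\<exists>vs. occurrence_in_mesh p m vs \<and>
           stronger \<tau> F (perm m) vs (trivial_occurrence n (i, j))) \<or>
        (\<exists>r. mesh_pattern r \<and> mesh_contains m r \<and> containment_implies r q)"
      using step[OF l(1)] unfolding ij_eq R1_def by blast
    then obtain d where m: "m = add_point (Mesh n \<tau> R1) (i, j) d" unfolding star_def by blast
    obtain W' V' where W': "grid_embedding (len m) (perm m) N \<sigma> W' V'"
      and boxes': "\<And>s. s \<in> shading m \<Longrightarrow> box_points N \<sigma> W' V' s = {}"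
      and triv: "map W' (trivial_occurrence n (i, j)) = us"
      using add_point_embedding[OF p1 W boxes1 ij l(2)[unfolded ij_eq] m] us_eq by metis
    have mm: "mesh_pattern m" using mesh_pattern_add_point[OF p1 ij] m by simp
    note comp = occurrence_comp[OF _ mm \<sigma> _ W' boxes']
    from alt show ?thesis
    proof (elim disjE exE conjE)
      fix vs assume vs: "occurrence_in_mesh p m vs"
        and st: "stronger \<tau> F (perm m) vs (trivial_occurrence n (i, j))"
      have len: "len m = n + 1" using m by simp
      have "length vs = n" "set vs \<subseteq> {1..len m}"
        using vs p(1) by (auto simp: occurrence_in_mesh_def occurrence_in_perm_def
            subsequence_positions_def order_isomorphic_def simp del: upt_Suc)
      moreover have "length (trivial_occurrence n (i, j)) = n"
        using arg_cong[OF triv, of length] us_eq by simp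
      moreover have "set (trivial_occurrence n (i, j)) \<subseteq> {1..len m}"
        by (auto simp: trivial_occurrence_def len)
      ultimately have "stronger \<tau> F \<sigma> (map W' vs) us"
        using stronger_embedding[OF \<tau> F _ \<sigma> W' _ _ _ _ st] mm triv
        by (auto simp: mesh_pattern_def)
      then show ?thesis using strongest[OF comp[OF p(2) vs]] by simp
    next
      fix r assume "mesh_pattern r" "mesh_contains m r" "containment_implies r q"
      then show ?thesis
        using comp[of r] \<sigma> unfolding mesh_contains_def containment_implies_def perm_contains_def
        by blast
    qed
  qed
qed

end
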